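(* If $L$ is a latin square of order $n \geq 4$, then $\beta(G(L)) \leq 2n-2$.
   Context: A latin square $L$ of order $n$ is an $n\times n$ array with entries from a set of $n$ symbols such that each symbol occurs exactly once in each row and in each column. The latin square graph $G(L)$ is the graph whose $n^2$ vertices are the cells of $L$, where two distinct cells are adjacent if they share a row, share a column, or contain the same symbol. The metric dimension $\beta(G)$ of a connected graph $G$ is the minimum number $m$ of vertices $u_1,\dots,u_m$ of $G$ such that every vertex $v$ of $G$ is uniquely determined by its vector of graph distances $(d(u_1,v),\dots,d(u_m,v))$. *)

theory Defs
  imports "Graph_Theory.Graph_Theory"
begin

section \<open>Metric dimension\<close>

text \<open>With all arc weights equal to 1, the cost of a walk is its length, so the cost of a
  shortest path is the usual graph distance (and \<open>\<infinity>\<close> if there is no path).\<close>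

definition graph_dist :: "('v, 'e) pre_digraph \<Rightarrow> 'v \<Rightarrow> 'v \<Rightarrow> ereal" where
  "graph_dist G u v = wf_digraph.\<mu> G (\<lambda>_. 1) u v"

definition resolving :: "('v, 'e) pre_digraph \<Rightarrow> 'v list \<Rightarrow> bool" where
  "resolving G us \<longleftrightarrow> set us \<subseteq> verts G \<and>
     inj_on (\<lambda>v. map (\<lambda>u. graph_dist G u v) us) (verts G)"

definition metric_dim :: "('v, 'e) pre_digraph \<Rightarrow> nat" where
  "metric_dim G = (LEAST m. \<exists>us. length us = m \<and> resolving G us)"

lemma (in wf_digraph) graph_dist_eq_0_iff:
  assumes "u \<in> verts G"
  shows "graph_dist G u v = 0 \<longleftrightarrow> u = v"
proof
  assume d: "graph_dist G u v = 0"
  show "u = v"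
  proof (rule ccontr)
    assume "u \<noteq> v"
    have "1 \<le> ereal (awalk_cost (\<lambda>_. 1) p)" if "awalk u p v" for p
    proof -
      from that \<open>u \<noteq> v\<close> obtain e q where "p = e # q"
        by (cases p) (auto simp: awalk_Nil_iff)
      moreover have "0 \<le> awalk_cost (\<lambda>_. 1) q"
        by (simp add: awalk_cost_def sum_list_triv)
      ultimately show ?thesis by simp
    qed
    then have "1 \<le> graph_dist G u v"
      unfolding graph_dist_def \<mu>_def by (auto intro: INF_greatest)
    with d show False by simp
  qed
next
  assume "u = v"
  with assms have "awalk u [] v" by (simp add: awalk_Nil_iff)
  from min_cost_le_walk_cost[OF this] have "graph_dist G u v \<le> 0"
    unfolding graph_dist_def by (rule order_trans) (simp add: awalk_cost_def)
  moreover have "0 \<le> graph_dist G u v"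
    unfolding graph_dist_def \<mu>_def
    by (auto intro!: INF_greatest simp: awalk_cost_def sum_list_triv)
  ultimately show "graph_dist G u v = 0" by simp
qed

text \<open>On a finite vertex set the minimum in \<^const>\<open>metric_dim\<close> ranges over a nonempty set.\<close>

lemma (in wf_digraph) metric_dim_attained:
  assumes "finite (verts G)"
  shows "\<exists>us. length us = metric_dim G \<and> resolving G us"
proof -
  obtain us where us: "set us = verts G" using finite_list[OF assms] by blast
  have "v = w" if "v \<in> verts G" "w \<in> verts G"
    "map (\<lambda>u. graph_dist G u v) us = map (\<lambda>u. graph_dist G u w) us" for v w
  proof -
    from that us have "graph_dist G v v = graph_dist G v w" by (metis map_eq_conv)
    with that show ?thesis using graph_dist_eq_0_iff[of v] by metis
  qed
  then have "resolving G us"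
    unfolding resolving_def using us by (auto intro!: inj_onI)
  then show ?thesis unfolding metric_dim_def
    by (rule_tac LeastI_ex) blast
qed


section \<open>Latin squares and their graphs\<close>

text \<open>Rows and columns are indexed by \<open>{..<n}\<close>; \<open>S\<close> is the symbol set, and the values of \<open>L\<close>
  outside \<open>{..<n} \<times> {..<n}\<close> are irrelevant.\<close>

definition latin_square :: "nat \<Rightarrow> 'a set \<Rightarrow> (nat \<Rightarrow> nat \<Rightarrow> 'a) \<Rightarrow> bool" where
  "latin_square n S L \<longleftrightarrow>
     finite S \<and> card S = n \<and>
     (\<forall>i<n. \<forall>j<n. L i j \<in> S) \<and>
     (\<forall>i<n. \<forall>s\<in>S. \<exists>!j. j < n \<and> L i j = s) \<and>
     (\<forall>j<n. \<forall>s\<in>S. \<exists>!i. i < n \<and> L i j = s)"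

definition latin_square_graph ::
    "nat \<Rightarrow> (nat \<Rightarrow> nat \<Rightarrow> 'a) \<Rightarrow> (nat \<times> nat) pair_pre_digraph" where
  "latin_square_graph n L =
     \<lparr> pverts = {..<n} \<times> {..<n},
       parcs = {((i, j), (k, l)). i < n \<and> j < n \<and> k < n \<and> l < n \<and> (i, j) \<noteq> (k, l) \<and>
                  (i = k \<or> j = l \<or> L i j = L k l)} \<rparr>"

lemma pair_graph_latin_square_graph: "pair_graph (latin_square_graph n L)"
proof -
  let ?H = "latin_square_graph n L"
  have sub: "parcs ?H \<subseteq> pverts ?H \<times> pverts ?H"
    by (auto simp: latin_square_graph_def)
  have fin: "finite (pverts ?H)"
    by (simp add: latin_square_graph_def)
  have noloop: "fst e \<noteq> snd e" if "e \<in> parcs ?H" for e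
    using that by (auto simp: latin_square_graph_def)
  have "sym (parcs ?H)"
    by (rule symI) (auto simp: latin_square_graph_def)
  then have sym: "symmetric (with_proj ?H)"
    by (simp add: symmetric_def)
  have fin': "finite (parcs ?H)"
    by (rule finite_subset[OF sub]) (intro finite_cartesian_product fin)
  show ?thesis
  proof
    fix e assume "e \<in> parcs ?H"
    then have "e \<in> pverts ?H \<times> pverts ?H" using sub by (rule rev_subsetD)
    then show "fst e \<in> pverts ?H" "snd e \<in> pverts ?H"
      by (simp_all add: mem_Times_iff)
  qed (fact fin fin' noloop sym)+
qed

lemma connected_latin_square_graph:
  assumes "n > 0"
  shows "connected (with_proj (latin_square_graph n L))"
proof -
  interpret pair_graph "latin_square_graph n L"
    by (rule pair_graph_latin_square_graph)
  let ?G = "with_proj (latin_square_graph n L)"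
  have step: "x \<rightarrow>\<^sup>*\<^bsub>?G\<^esub> y"
    if "x \<in> {..<n} \<times> {..<n}" "y \<in> {..<n} \<times> {..<n}" "fst x = fst y \<or> snd x = snd y" for x y
  proof (cases "x = y")
    case True
    moreover from that have "y \<in> pverts (latin_square_graph n L)"
      by (simp add: latin_square_graph_def)
    ultimately show ?thesis using reachable_refl[of y] by simp
  next
    case False
    with that have "(x, y) \<in> parcs (latin_square_graph n L)"
      by (auto simp: latin_square_graph_def)
    then show ?thesis by auto
  qed
  have reach: "x \<rightarrow>\<^sup>*\<^bsub>?G\<^esub> y"
    if "x \<in> {..<n} \<times> {..<n}" "y \<in> {..<n} \<times> {..<n}" for x y
  proof (rule reachable_trans)
    show "x \<rightarrow>\<^sup>*\<^bsub>?G\<^esub> (fst x, snd y)" "(fst x, snd y) \<rightarrow>\<^sup>*\<^bsub>?G\<^esub> y"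
      using that by (auto intro!: step)
  qed
  have V: "verts ?G = {..<n} \<times> {..<n}"
    by (simp add: latin_square_graph_def)
  show ?thesis
  proof (rule connectedI)
    show "pverts (latin_square_graph n L) \<noteq> {}"
      using assms V by auto
    show "x \<rightarrow>\<^sup>*\<^bsub>with_proj (mk_symmetric ?G)\<^esub> y"
      if "x \<in> pverts (latin_square_graph n L)" "y \<in> pverts (latin_square_graph n L)" for x y
      using that V by (intro reachable_mk_symmetricI reach) simp_all
  qed
qed

end

theory Submission
  imports Defs
begin

text \<open>The \<open>2n - 2\<close> cells of two rows outside one common column form a resolving set. A cell
  outside both rows, in column \<open>j\<close> and with symbol \<open>k\<close>, sees in each of the rows the columns \<open>j\<close>
  and the position of \<open>k\<close>; the latter differs between the rows, so the two sets of seen columns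
  meet in \<open>j\<close> alone. Omitting the same column from both rows still allows \<open>j\<close> and then \<open>k\<close> to be
  recovered: an omitted column shows up as a missing element.\<close>

text \<open>A walk with at least two arcs costs at least 2, so cost at most 1 leaves only the empty
  walk and single arcs. This reduces distances to closeness of cells.\<close>

lemma (in wf_digraph) graph_dist_le_1_iff:
  assumes "u \<in> verts G"
  shows "graph_dist G u v \<le> 1 \<longleftrightarrow> u = v \<or> u \<rightarrow> v"
proof
  assume d: "graph_dist G u v \<le> 1"
  show "u = v \<or> u \<rightarrow> v"
  proof (rule ccontr)
    assume non: "\<not> (u = v \<or> u \<rightarrow> v)"
    have "2 \<le> ereal (awalk_cost (\<lambda>_. 1) p)" if p: "awalk u p v" for p
    proof -
      obtain e f q where "p = e # f # q"
      proof (cases p rule: remdups_adj.cases)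
        case 1
        with p non show ?thesis by (simp add: awalk_Nil_iff)
      next
        case (2 e)
        with p have "u \<rightarrow> v"
          by (auto simp: awalk_Cons_iff awalk_Nil_iff intro: in_arcs_imp_in_arcs_ends)
        with non show ?thesis by simp
      qed (use that in blast)
      moreover have "0 \<le> awalk_cost (\<lambda>_. 1) q"
        by (simp add: awalk_cost_def sum_list_triv)
      ultimately show ?thesis by simp
    qed
    then have "2 \<le> graph_dist G u v"
      unfolding graph_dist_def \<mu>_def by (auto intro: INF_greatest)
    from order_trans[OF this d] show False by simp
  qed
next
  assume "u = v \<or> u \<rightarrow> v"
  then show "graph_dist G u v \<le> 1"
  proof
    assume "u = v"
    with assms show ?thesis using graph_dist_eq_0_iff[of u v] by simp
  next
    assume "u \<rightarrow> v"
    then obtain e where "e \<in> arcs G" "tail G e = u" "head G e = v" by auto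
    then have "awalk u [e] v" by (auto simp: awalk_Cons_iff awalk_Nil_iff)
    from min_cost_le_walk_cost[OF this, of "\<lambda>_. 1"] show ?thesis
      unfolding graph_dist_def by (simp add: one_ereal_def)
  qed
qed

lemma latin_square_graph_dist_le_1_iff:
  assumes "i < n" "j < n" "k < n" "l < n"
  shows "graph_dist (with_proj (latin_square_graph n L)) (i, j) (k, l) \<le> 1 \<longleftrightarrow>
    i = k \<or> j = l \<or> L i j = L k l"
proof -
  interpret pair_graph "latin_square_graph n L"
    by (rule pair_graph_latin_square_graph)
  show ?thesis
    using graph_dist_le_1_iff[of "(i, j)" "(k, l)"] assms
    by (auto simp: latin_square_graph_def)
qed

lemma latin_square_row_inj:
  assumes "latin_square n S L" "i < n" "j < n" "j' < n" "L i j = L i j'"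
  shows "j = j'"
  using assms unfolding latin_square_def by metis

lemma latin_square_col_inj:
  assumes "latin_square n S L" "i < n" "i' < n" "j < n" "L i j = L i' j"
  shows "i = i'"
  using assms unfolding latin_square_def by metis

lemma latin_square_row_surj:
  assumes "latin_square n S L" "i < n" "k < n" "l < n"
  obtains j where "j < n" "L i j = L k l"
  using assms unfolding latin_square_def by metis

text \<open>A cell of a row is close to all remaining cells of that row, whereas a cell outside the row
  is close to at most two.\<close>

lemma latin_square_row_twins:
  assumes L: "latin_square n S L" and n: "n \<ge> 4"
    and lt: "r < n" "k < n" "l < n"
    and near: "\<And>c. 0 < c \<Longrightarrow> c < n \<Longrightarrow> r = k \<or> c = l \<or> L r c = L k l"
  shows "r = k"
proof (rule ccontr)
  assume "r \<noteq> k"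
  with near have *: "c = l \<or> L r c = L k l" if "0 < c" "c < n" for c
    using that by blast
  \<comment> \<open>As \<open>n \<ge> 4\<close>, the columns 1, 2, 3 exist and at most one of them
    is \<open>l\<close>. The witness \<open>3 - l\<close> is whichever of 1 and 2 differs from
    \<open>l\<close>.\<close>
  have "\<exists>a b. 0 < a \<and> a < b \<and> b < n \<and> a \<noteq> l \<and> b \<noteq> l"
  proof (cases "l = 1 \<or> l = 2")
    case True
    with n show ?thesis by (intro exI[of _ "3 - l"] exI[of _ 3]) auto
  next
    case False
    with n show ?thesis by (intro exI[of _ 1] exI[of _ 2]) auto
  qed
  then obtain a b where ab: "0 < a" "a < b" "b < n" "a \<noteq> l" "b \<noteq> l" by blast
  then have "L r a = L r b" using *[of a] *[of b] by simp
  with ab show False using latin_square_row_inj[OF L lt(1), of a b] by simp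
qed

text \<open>The assumption \<open>out\<close> says that neither cell is among the chosen ones, the
  omitted column being 0; \<open>same\<close> is what equal distance vectors give when each distance
  is compared with 1.\<close>

lemma latin_square_two_rows_resolve:
  assumes L: "latin_square n S L" and n: "n \<ge> 4"
    and lt: "i < n" "j < n" "k < n" "l < n"
    and out: "i < 2 \<Longrightarrow> j = 0" "k < 2 \<Longrightarrow> l = 0"
    and same: "\<And>r c. r < 2 \<Longrightarrow> 0 < c \<Longrightarrow> c < n \<Longrightarrow>
      (r = i \<or> c = j \<or> L r c = L i j) \<longleftrightarrow> (r = k \<or> c = l \<or> L r c = L k l)"
  shows "(i, j) = (k, l)"
proof (cases "i < 2 \<or> k < 2")
  case True
  have "i = k" if "i < 2"
    by (rule latin_square_row_twins[OF L n lt(1,3,4)]) (use same[OF that] in blast)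
  moreover have "k = i" if "k < 2"
    by (rule latin_square_row_twins[OF L n lt(3,1,2)]) (use same[OF that] in blast)
  ultimately show ?thesis using True out by auto
next
  case False
  have rows: "0 < n" "1 < n" using n by auto
  \<comment> \<open>Rows 0 and 1 carry the symbol of \<open>(i, j)\<close> in columns
    \<open>p\<close> and \<open>q\<close>, and that of \<open>(k, l)\<close> in \<open>p'\<close>
    and \<open>q'\<close>.\<close>
  obtain p where p: "p < n" "L 0 p = L i j"
    using latin_square_row_surj[OF L rows(1) lt(1,2)] by blast
  obtain q where q: "q < n" "L 1 q = L i j"
    using latin_square_row_surj[OF L rows(2) lt(1,2)] by blast
  obtain p' where p': "p' < n" "L 0 p' = L k l"
    using latin_square_row_surj[OF L rows(1) lt(3,4)] by blast
  obtain q' where q': "q' < n" "L 1 q' = L k l"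
    using latin_square_row_surj[OF L rows(2) lt(3,4)] by blast
  note col = latin_square_col_inj[OF L]
  have "p \<noteq> j" using col[of 0 i j] p lt False rows by auto
  have "q \<noteq> j" using col[of 1 i j] q lt False rows by auto
  have "p' \<noteq> l" using col[of 0 k l] p' lt False rows by auto
  have "q' \<noteq> l" using col[of 1 k l] q' lt False rows by auto
  have "p \<noteq> q" using col[of 0 1 p] p q rows by auto
  have "p' \<noteq> q'" using col[of 0 1 p'] p' q' rows by auto
  have inj0: "L 0 c = L 0 d \<longleftrightarrow> c = d" if "c < n" "d < n" for c d
    using latin_square_row_inj[OF L rows(1) that] by blast
  have inj1: "L 1 c = L 1 d \<longleftrightarrow> c = d" if "c < n" "d < n" for c d
    using latin_square_row_inj[OF L rows(2) that] by blast
  \<comment> \<open>Apart from column 0, the sets \<open>{j, p}\<close> and \<open>{l, p'}\<close>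
    agree; likewise \<open>{j, q}\<close> and \<open>{l, q'}\<close> in row 1.\<close>
  have s0: "c = j \<or> c = p \<longleftrightarrow> c = l \<or> c = p'" if "0 < c" "c < n" for c
    using same[of 0 c] that False p p' inj0[of c p] inj0[of c p'] by auto
  have s1: "c = j \<or> c = q \<longleftrightarrow> c = l \<or> c = q'" if "0 < c" "c < n" for c
    using same[of 1 c] that False q q' inj1[of c q] inj1[of c q'] by auto
  \<comment> \<open>Intersect the sets of the two rows: \<open>p \<noteq> q\<close> and
    \<open>p' \<noteq> q'\<close> leave only \<open>j\<close> and \<open>l\<close>.\<close>
  have "c = j \<longleftrightarrow> c = l" if "0 < c" "c < n" for c
    using s0[OF that] s1[OF that] \<open>p \<noteq> q\<close> \<open>p' \<noteq> q'\<close> by blast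
  \<comment> \<open>If either column is nonzero, the other equals it; otherwise both are the omitted
    column 0.\<close>
  then have "j = l" using lt by (metis gr0I)
  then have "c = p \<longleftrightarrow> c = p'" if "0 < c" "c < n" for c
    using s0[OF that] \<open>p \<noteq> j\<close> \<open>p' \<noteq> l\<close> by blast
  then have "p = p'" using p(1) p'(1) by (metis gr0I)
  \<comment> \<open>Both symbols are the entry of row 0 in column \<open>p\<close>, and a symbol
    occurs only once in column \<open>j\<close>.\<close>
  with p p' \<open>j = l\<close> have "L i j = L k j" by simp
  with \<open>j = l\<close> show ?thesis using col lt by blast
qed

theorem theorem3p3:
  fixes n :: nat and S :: "'a set" and L :: "nat \<Rightarrow> nat \<Rightarrow> 'a"
  assumes "n \<ge> 4" and "latin_square n S L"
  shows "metric_dim (with_proj (latin_square_graph n L)) \<le> 2 * n - 2"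
proof -
  let ?G = "with_proj (latin_square_graph n L)"
  let ?us = "List.product [0..<2] [1..<n]"
  interpret pair_graph "latin_square_graph n L"
    by (rule pair_graph_latin_square_graph)
  have V: "verts ?G = {..<n} \<times> {..<n}"
    by (simp add: latin_square_graph_def)
  have W: "(r, c) \<in> set ?us \<longleftrightarrow> r < 2 \<and> 0 < c \<and> c < n" for r c by auto
  have sub: "set ?us \<subseteq> verts ?G" unfolding V using assms(1) by auto
  have "v = w"
    if vw: "v \<in> verts ?G" "w \<in> verts ?G"
      and eq: "map (\<lambda>u. graph_dist ?G u v) ?us = map (\<lambda>u. graph_dist ?G u w) ?us" for v w
  proof -
    have same: "graph_dist ?G u v = graph_dist ?G u w" if "u \<in> set ?us" for u
      using eq[unfolded map_eq_conv] that by (rule bspec)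
    show ?thesis
    \<comment> \<open>A chosen cell is at distance 0 from itself alone, so its own coordinate
      singles it out.\<close>
    proof (cases "v \<in> set ?us \<or> w \<in> set ?us")
      case True
      then have "graph_dist ?G v v = graph_dist ?G v w \<or> graph_dist ?G w v = graph_dist ?G w w"
        using same by blast
      then show ?thesis
        using vw graph_dist_eq_0_iff[of v v] graph_dist_eq_0_iff[of v w]
          graph_dist_eq_0_iff[of w v] graph_dist_eq_0_iff[of w w] by auto
    next
      case False
      obtain i j k l where ij: "v = (i, j)" and kl: "w = (k, l)" by fastforce
      with vw have lt: "i < n" "j < n" "k < n" "l < n" unfolding V by auto
      have "(i, j) = (k, l)"
      proof (rule latin_square_two_rows_resolve[OF assms(2,1) lt])
        show "j = 0" if "i < 2" using False that lt unfolding ij W by simp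
        show "l = 0" if "k < 2" using False that lt unfolding kl W by simp
        fix r c :: nat assume rc: "r < 2" "0 < c" "c < n"
        then have "graph_dist ?G (r, c) (i, j) = graph_dist ?G (r, c) (k, l)"
          using same W unfolding ij kl by blast
        moreover have "r < n" using rc assms(1) by simp
        ultimately show "(r = i \<or> c = j \<or> L r c = L i j) \<longleftrightarrow>
            (r = k \<or> c = l \<or> L r c = L k l)"
          using latin_square_graph_dist_le_1_iff[of r n c i j L]
            latin_square_graph_dist_le_1_iff[of r n c k l L] rc(3) lt by simp
      qed
      then show ?thesis by (simp add: ij kl)
    qed
  qed
  then have "inj_on (\<lambda>v. map (\<lambda>u. graph_dist ?G u v) ?us) (verts ?G)"
    by (rule inj_onI)
  with sub have "resolving ?G ?us"
    unfolding resolving_def by (rule conjI)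
  moreover have "length ?us = 2 * n - 2" by (simp add: length_product)
  ultimately show ?thesis
    unfolding metric_dim_def by (blast intro: Least_le)
qed

end
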